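(* The system $$\dot W=[W,M_1]+[\Theta,M_2],\qquad \dot\Theta=[\Theta,M_1],\qquad W,\Theta\in\mathfrak{su}(N),\quad M_1=\Delta_N^{-1}W,\quad M_2=\Delta_N\Theta,$$ is a Lie--Poisson flow on the dual $\mathfrak f^*$ of the Lie algebra $\mathfrak f=\mathfrak{su}(N)\ltimes\mathfrak{su}(N)^*$: $$\dot J=\operatorname{ad}^*_MJ,$$ where $J=(\Theta,W^\dagger)\in\mathfrak f^*$, $M=(M_1,M_2^\dagger)\in\mathfrak f$, with the Hamiltonian $$H(W,\Theta)=\frac12\left(\operatorname{tr}(W^\dagger M_1)+\operatorname{tr}(\Theta^\dagger M_2)\right).$$
   Context: $N\ge2$, $\hbar=2/\sqrt{N^2-1}$; $\mathfrak{su}(N)$ is the Lie algebra of trace-free skew-Hermitian $N\times N$ matrices. Let $X_1,X_2,X_3$ be Hermitian generators of the spin-$(N-1)/2$ unitary irreducible representation of $\mathfrak{so}(3)$ with $\frac1\hbar[X_a,X_b]=\mathrm i\varepsilon_{abc}X_c$, $X_1^2+X_2^2+X_3^2=\mathbb I$. The Hoppe--Yau Laplacian $\Delta_N(A)=-\frac1{\hbar^2}\sum_{a=1}^3[X_a,[X_a,A]]$ is self-adjoint for the Frobenius inner product and restricts to a bijection $\mathfrak{su}(N)\to\mathfrak{su}(N)$ with eigenvalues $-l(l+1)$, $l=1,\dots,N-1$. $\mathfrak{su}(N)^*$ is identified with $\mathfrak{su}(N)$ via $\langle A,B\rangle=\operatorname{tr}(A^\dagger B)$, so $\operatorname{ad}^*_vb=[v^\dagger,b]$.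 The Lie algebra $\mathfrak f=\mathfrak{su}(N)\ltimes\mathfrak{su}(N)^*$ is that of the group $F=\mathrm{SU}(N)\ltimes\mathfrak{su}(N)^*$ with product $(\varphi,a)\cdot(\psi,b)=(\varphi\psi,\operatorname{Ad}^*_\psi a+b)$; its adjoint operator is $\operatorname{ad}_{(v,a)}(w,b)=([v,w],\operatorname{ad}^*_wa-\operatorname{ad}^*_vb)$. The dual $\mathfrak f^*$ is identified with $\mathfrak{su}(N)\times\mathfrak{su}(N)^*$ via $\langle(\xi,a),(w,b)\rangle=\langle b,\xi\rangle+\langle a,w\rangle$, and the coadjoint operator is $\operatorname{ad}^*_{(v,a)}(w,b)=([w,v],\operatorname{ad}^*_vb-\operatorname{ad}^*_wa)=([w,v],[v^\dagger,b]+[a,w^\dagger])$ for $(v,a)\in\mathfrak f$, $(w,b)\in\mathfrak f^*$. A Lie--Poisson flow on $\mathfrak f^*$ is the Hamiltonian flow of a function $H$ for the Lie--Poisson bracket $\{F,G\}(J)=\pm\langle J,[dF(J),dG(J)]\rangle$; it has the form $\dot J=\operatorname{ad}^*_MJ$ with $M$ given, up to the overall sign convention, by the differential of $H$ at $J$ (here, the Frobenius gradients of $H$ with respect to $W$ and $\Theta$ are $M_1$ and $M_2$). *)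

theory Defs
  imports "HOL-Analysis.Analysis"
begin

type_synonym 'n cmat = "complex ^ 'n ^ 'n"

definition dagger :: "'n::finite cmat \<Rightarrow> 'n cmat"
  where "dagger A = (\<chi> i j. cnj (A $ j $ i))"

definition comm :: "'n::finite cmat \<Rightarrow> 'n cmat \<Rightarrow> 'n cmat"
  where "comm A B = A ** B - B ** A"

definition su :: "'n::finite cmat set"
  where "su = {A. dagger A = - A \<and> trace A = 0}"

text \<open>The trace below is real whenever both arguments are in \<^const>\<open>su\<close>; see
  \<open>trace_dagger_mult_su\<close>. The real part only fixes the codomain.\<close>

definition frob :: "'n::finite cmat \<Rightarrow> 'n cmat \<Rightarrow> real"
  where "frob A B = Re (trace (dagger A ** B))"


subsection \<open>The Hoppe--Yau Laplacian\<close>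

definition hbar :: "nat \<Rightarrow> real"
  where "hbar N = 2 / sqrt ((real N)\<^sup>2 - 1)"

text \<open>Only the cyclic instances of $[X_a,X_b] = \mathrm{i}\hbar\varepsilon_{abc}X_c$ are listed;
  the others follow by antisymmetry. An irreducible representation on an $N$-dimensional
  space has spin $(N-1)/2$.\<close>

definition spin_generators :: "(3 \<Rightarrow> 'n::finite cmat) \<Rightarrow> bool"
  where "spin_generators X \<longleftrightarrow>
     (\<forall>a. dagger (X a) = X a) \<and>
     comm (X 1) (X 2) = map_matrix ((*) (\<i> * complex_of_real (hbar CARD('n)))) (X 3) \<and>
     comm (X 2) (X 3) = map_matrix ((*) (\<i> * complex_of_real (hbar CARD('n)))) (X 1) \<and>
     comm (X 3) (X 1) = map_matrix ((*) (\<i> * complex_of_real (hbar CARD('n)))) (X 2) \<and>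
     X 1 ** X 1 + X 2 ** X 2 + X 3 ** X 3 = mat 1 \<and>
     (\<forall>V :: (complex ^ 'n) set.
        vec.subspace V \<and> (\<forall>a. \<forall>v\<in>V. X a *v v \<in> V) \<longrightarrow> V = {0} \<or> V = UNIV)"

definition hoppe_yau :: "(3 \<Rightarrow> 'n::finite cmat) \<Rightarrow> 'n cmat \<Rightarrow> 'n cmat"
  where "hoppe_yau X A =
    - ((1 / (hbar CARD('n))\<^sup>2) *\<^sub>R (\<Sum>a\<in>UNIV. comm (X a) (comm (X a) A)))"

definition hoppe_yau_inv :: "(3 \<Rightarrow> 'n::finite cmat) \<Rightarrow> 'n cmat \<Rightarrow> 'n cmat"
  where "hoppe_yau_inv X = inv_into su (hoppe_yau X)"


subsection \<open>The semidirect product Lie algebra and its dual\<close>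

text \<open>With the dual of \<^const>\<open>su\<close> identified with \<^const>\<open>su\<close> through \<^const>\<open>frob\<close>, the Lie
  algebra and its dual have the same underlying set of pairs, but different operations.\<close>

definition f_alg :: "('n::finite cmat \<times> 'n cmat) set"
  where "f_alg = su \<times> su"

definition f_dual :: "('n::finite cmat \<times> 'n cmat) set"
  where "f_dual = su \<times> su"

definition su_coad :: "'n::finite cmat \<Rightarrow> 'n cmat \<Rightarrow> 'n cmat"
  where "su_coad v b = comm (dagger v) b"

text \<open>The adjoint operator, that is, the Lie bracket of \<^const>\<open>f_alg\<close>.\<close>

fun f_ad :: "'n::finite cmat \<times> 'n cmat \<Rightarrow> 'n cmat \<times> 'n cmat \<Rightarrow> 'n cmat \<times> 'n cmat"
  where "f_ad (v, a) (w, b) = (comm v w, su_coad w a - su_coad v b)"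

fun f_pair :: "'n::finite cmat \<times> 'n cmat \<Rightarrow> 'n cmat \<times> 'n cmat \<Rightarrow> real"
  where "f_pair (\<xi>, a) (w, b) = frob b \<xi> + frob a w"

fun f_coad :: "'n::finite cmat \<times> 'n cmat \<Rightarrow> 'n cmat \<times> 'n cmat \<Rightarrow> 'n cmat \<times> 'n cmat"
  where "f_coad (v, a) (w, b) = (comm w v, su_coad v b - su_coad w a)"


subsection \<open>Differentials, the Lie--Poisson bracket and Hamiltonian flows\<close>

definition has_frob_gradient :: "('n::finite cmat \<Rightarrow> real) \<Rightarrow> 'n cmat \<Rightarrow> 'n cmat \<Rightarrow> bool"
  where "has_frob_gradient f A G \<longleftrightarrow> G \<in> su \<and> (f has_derivative frob G) (at A within su)"

text \<open>The differential of a function on the dual is an element of the Lie algebra. Only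
  increments in \<^const>\<open>f_dual\<close> are tested, which determines it uniquely; see
  \<open>has_differential_unique\<close>.\<close>

definition has_differential ::
  "('n::finite cmat \<times> 'n cmat \<Rightarrow> real) \<Rightarrow> 'n cmat \<times> 'n cmat \<Rightarrow> 'n cmat \<times> 'n cmat \<Rightarrow> bool"
  where "has_differential F J \<xi> \<longleftrightarrow>
    \<xi> \<in> f_alg \<and> (F has_derivative (\<lambda>K. f_pair K \<xi>)) (at J within f_dual)"

definition differential ::
  "('n::finite cmat \<times> 'n cmat \<Rightarrow> real) \<Rightarrow> 'n cmat \<times> 'n cmat \<Rightarrow> 'n cmat \<times> 'n cmat"
  where "differential F J = (THE \<xi>. has_differential F J \<xi>)"

text \<open>Of the two conventional signs of the bracket the plus sign is taken, together with
  $\dot F = \{F,H\}$ for the flow of $H$.\<close>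

definition lie_poisson ::
  "('n::finite cmat \<times> 'n cmat \<Rightarrow> real) \<Rightarrow> ('n cmat \<times> 'n cmat \<Rightarrow> real) \<Rightarrow>
   'n cmat \<times> 'n cmat \<Rightarrow> real"
  where "lie_poisson F G J = f_pair J (f_ad (differential F J) (differential G J))"

definition lie_poisson_flow ::
  "('n::finite cmat \<times> 'n cmat \<Rightarrow> real) \<Rightarrow> real set \<Rightarrow> (real \<Rightarrow> 'n cmat \<times> 'n cmat) \<Rightarrow> bool"
  where "lie_poisson_flow H T J \<longleftrightarrow>
    H differentiable_on f_dual \<and>
    (\<forall>t\<in>T. J t \<in> f_dual) \<and>
    (\<forall>F. F differentiable_on f_dual \<longrightarrow>
      (\<forall>t\<in>T. ((\<lambda>s. F (J s)) has_real_derivative lie_poisson F H (J t)) (at t within T)))"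


subsection \<open>The system\<close>

definition solves_system ::
  "(3 \<Rightarrow> 'n::finite cmat) \<Rightarrow> real set \<Rightarrow> (real \<Rightarrow> 'n cmat) \<Rightarrow> (real \<Rightarrow> 'n cmat) \<Rightarrow> bool"
  where "solves_system X T W \<Theta> \<longleftrightarrow>
    (\<forall>t\<in>T. let M1 = hoppe_yau_inv X (W t); M2 = hoppe_yau X (\<Theta> t) in
      (W has_vector_derivative (comm (W t) M1 + comm (\<Theta> t) M2)) (at t within T) \<and>
      (\<Theta> has_vector_derivative comm (\<Theta> t) M1) (at t within T))"

definition J_of :: "'n::finite cmat \<Rightarrow> 'n cmat \<Rightarrow> 'n cmat \<times> 'n cmat"
  where "J_of W \<Theta> = (\<Theta>, dagger W)"

definition M_of :: "(3 \<Rightarrow> 'n::finite cmat) \<Rightarrow> 'n cmat \<Rightarrow> 'n cmat \<Rightarrow> 'n cmat \<times> 'n cmat"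
  where "M_of X W \<Theta> = (hoppe_yau_inv X W, dagger (hoppe_yau X \<Theta>))"

definition hamiltonian :: "(3 \<Rightarrow> 'n::finite cmat) \<Rightarrow> 'n cmat \<Rightarrow> 'n cmat \<Rightarrow> real"
  where "hamiltonian X W \<Theta> = (frob W (hoppe_yau_inv X W) + frob \<Theta> (hoppe_yau X \<Theta>)) / 2"

text \<open>The same Hamiltonian in the variable $J = (\Theta, W^\dagger)$.\<close>

fun hamiltonian_J :: "(3 \<Rightarrow> 'n::finite cmat) \<Rightarrow> 'n cmat \<times> 'n cmat \<Rightarrow> real"
  where "hamiltonian_J X (\<xi>, a) = hamiltonian X (dagger a) \<xi>"


subsection \<open>Consistency of the conventions\<close>

lemma dagger_dagger [simp]: "dagger (dagger A) = A"
  by (simp add: dagger_def vec_eq_iff)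

lemma dagger_add: "dagger (A + B) = dagger A + dagger B"
  and dagger_diff: "dagger (A - B) = dagger A - dagger B"
  and dagger_minus: "dagger (- A) = - dagger A"
  and dagger_scaleR: "dagger (c *\<^sub>R A) = c *\<^sub>R dagger A"
  by (simp_all add: dagger_def vec_eq_iff)

lemma dagger_mult: "dagger (A ** B) = dagger B ** dagger A"
  by (simp add: dagger_def matrix_matrix_mult_def vec_eq_iff mult.commute)

lemma dagger_comm: "dagger (comm A B) = comm (dagger B) (dagger A)"
  by (simp add: comm_def dagger_mult dagger_diff)

lemma trace_dagger: "trace (dagger A) = cnj (trace A)"
  by (simp add: trace_def dagger_def)

lemma trace_minus: "trace (- A) = - trace (A :: 'n::finite cmat)"
  and trace_scaleR: "trace (c *\<^sub>R A) = c *\<^sub>R trace (A :: 'n cmat)"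
  by (simp_all add: trace_def sum_negf scaleR_sum_right)

lemma matrix_diff_distrib:
  fixes A B C :: "'n::finite cmat"
  shows "A ** (B - C) = A ** B - A ** C" "(A - B) ** C = A ** C - B ** C"
  by (simp_all add: vec_eq_iff matrix_matrix_mult_def sum_subtractf algebra_simps)

lemma matrix_minus_mult:
  fixes A B :: "'n::finite cmat"
  shows "(- A) ** B = - (A ** B)" "A ** (- B) = - (A ** B)"
  by (simp_all add: vec_eq_iff matrix_matrix_mult_def sum_negf)

lemma trace_comm: "trace (comm A B) = 0"
  by (simp add: comm_def trace_sub trace_mul_sym[of A B])

lemma trace_dagger_mult_su:
  assumes "A \<in> su" "B \<in> su"
  shows "trace (dagger A ** B) = of_real (frob A B)"
proof -
  have "cnj (trace (dagger A ** B)) = trace (dagger B ** A)"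
    by (simp add: trace_dagger[symmetric] dagger_mult)
  also have "\<dots> = trace (dagger A ** B)"
    using assms by (simp add: su_def matrix_minus_mult trace_minus trace_mul_sym[of A B])
  finally show ?thesis
    unfolding frob_def by (simp add: Reals_cnj_iff)
qed

lemma frob_eq_inner: "frob A B = A \<bullet> B"
proof -
  have "frob A B = (\<Sum>i\<in>UNIV. \<Sum>j\<in>UNIV. A $ j $ i \<bullet> B $ j $ i)"
    by (simp add: frob_def trace_def matrix_matrix_mult_def dagger_def inner_complex_def)
  also have "\<dots> = A \<bullet> B"
    by (subst sum.swap) (simp add: inner_vec_def)
  finally show ?thesis .
qed

lemma comm_su: "A \<in> su \<Longrightarrow> B \<in> su \<Longrightarrow> comm A B \<in> su"
  by (simp add: su_def dagger_comm trace_comm) (simp add: comm_def matrix_minus_mult)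

lemma subspace_su: "subspace su"
  by (auto simp: subspace_def su_def dagger_add dagger_scaleR trace_add trace_scaleR)
    (simp_all add: dagger_def trace_def vec_eq_iff)

lemma su_coad_su: "v \<in> su \<Longrightarrow> b \<in> su \<Longrightarrow> su_coad v b \<in> su"
  unfolding su_coad_def by (rule comm_su) (auto simp: su_def dagger_minus trace_minus)

lemma f_ad_closed: "x \<in> f_alg \<Longrightarrow> y \<in> f_alg \<Longrightarrow> f_ad x y \<in> f_alg"
  by (cases x; cases y)
    (auto simp: f_alg_def intro!: comm_su su_coad_su subspace_diff[OF subspace_su])

lemma f_ad_alternating: "f_ad x x = 0"
  by (cases x) (simp add: comm_def zero_prod_def)

lemma f_ad_jacobi:
  "f_ad x (f_ad y z) + f_ad y (f_ad z x) + f_ad z (f_ad x y) = 0"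
  by (cases x; cases y; cases z)
    (simp add: comm_def su_coad_def zero_prod_def dagger_diff dagger_mult matrix_diff_distrib
      matrix_mul_assoc)

lemma frob_comm: "frob A (comm B C) = frob (comm (dagger B) A) C"
proof -
  have "trace (dagger A ** (C ** B)) = trace (B ** (dagger A ** C))"
    by (metis matrix_mul_assoc trace_mul_sym)
  then show ?thesis
    by (simp add: frob_def dagger_comm)
      (simp add: comm_def matrix_diff_distrib trace_sub matrix_mul_assoc)
qed

lemma f_coad_transpose: "f_pair (f_coad x J) y = f_pair J (f_ad x y)"
proof (cases x; cases y; cases J)
  fix v a w b \<xi> c assume "x = (v, a)" "y = (w, b)" "J = (\<xi>, c)"
  moreover have "frob b (comm \<xi> v) = - frob (comm (dagger v) b) \<xi>"
    by (metis frob_comm frob_eq_inner inner_minus_right minus_diff_eq comm_def)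
  moreover have "frob c (comm v w) = frob (comm (dagger v) c) w"
    by (rule frob_comm)
  moreover have "frob (comm (dagger \<xi>) a) w = - frob (comm (dagger w) a) \<xi>"
    by (metis frob_comm frob_eq_inner inner_minus_right minus_diff_eq comm_def)
  ultimately show ?thesis
    by (simp add: su_coad_def frob_eq_inner inner_diff_left)
qed

lemma has_differential_unique:
  fixes F :: "'n::finite cmat \<times> 'n cmat \<Rightarrow> real"
  assumes "has_differential F J \<xi>" "has_differential F J \<eta>" "J \<in> f_dual"
  shows "\<xi> = \<eta>"
proof -
  have sub: "subspace (f_dual :: ('n cmat \<times> 'n cmat) set)"
    unfolding f_dual_def by (rule subspace_Times[OF subspace_su subspace_su])
  have eq: "f_pair K \<xi> = f_pair K \<eta>" if "K \<in> f_dual" for K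
  proof -
    have line: "((\<lambda>t. J + t *\<^sub>R K) has_derivative (\<lambda>t. t *\<^sub>R K)) (at 0)"
      by (auto intro!: derivative_eq_intros)
    have img: "range (\<lambda>t. J + t *\<^sub>R K) \<subseteq> f_dual"
      using assms(3) that sub by (auto intro!: subspace_add subspace_scale)
    have D: "((\<lambda>t. F (J + t *\<^sub>R K)) has_derivative (\<lambda>t. f_pair (t *\<^sub>R K) \<zeta>)) (at 0)"
      if "has_differential F J \<zeta>" for \<zeta>
      using has_derivative_in_compose[OF line, of F "\<lambda>K. f_pair K \<zeta>"] that img
      by (auto simp: has_differential_def intro: has_derivative_subset)
    have "(\<lambda>t. f_pair (t *\<^sub>R K) \<xi>) = (\<lambda>t. f_pair (t *\<^sub>R K) \<eta>)"
      using has_derivative_unique D assms(1,2) by blast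
    from fun_cong[OF this, of 1] show ?thesis by simp
  qed
  obtain v a w b where \<xi>: "\<xi> = (v, a)" and \<eta>: "\<eta> = (w, b)"
    by (metis surj_pair)
  have "v \<in> su" "a \<in> su" "w \<in> su" "b \<in> su"
    using assms(1,2) by (auto simp: \<xi> \<eta> has_differential_def f_alg_def)
  then have "(a - b, v - w) \<in> f_dual"
    by (auto simp: f_dual_def intro: subspace_diff[OF subspace_su])
  from eq[OF this] have "(a - b) \<bullet> (a - b) + (v - w) \<bullet> (v - w) = 0"
    by (simp add: \<xi> \<eta> frob_eq_inner inner_diff inner_commute)
  then have "a - b = 0" "v - w = 0"
    by (metis add_nonneg_eq_0_iff inner_eq_zero_iff inner_ge_zero)+
  then show ?thesis by (simp add: \<xi> \<eta>)
qed

end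

theory Submission
  imports Defs
begin

text \<open>Write \<open>\<Delta>\<close> for the Hoppe--Yau Laplacian. It is a negative multiple of the sum of the squares of
  the maps \<open>[X\<^sub>a, -]\<close>, which are self-adjoint for the Frobenius product because the \<open>X\<^sub>a\<close> are
  Hermitian. So \<open>\<Delta>\<close> is self-adjoint and an element of its kernel commutes with every \<open>X\<^sub>a\<close>; by Schur's lemma
  (\<open>spin_commutant_su_trivial\<close>) such an element of \<^const>\<open>su\<close> vanishes. Hence \<open>\<Delta>\<close> is a self-adjoint
  bijection of \<^const>\<open>su\<close>, and \<open>H\<close> is half the sum of the quadratic forms of \<open>\<Delta>\<^sup>-\<^sup>1\<close> in \<open>W\<close> and of
  \<open>\<Delta>\<close> in \<open>\<Theta>\<close>. The gradient of half the quadratic form of a self-adjoint map is that map, which gives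
  the gradients \<open>M\<^sub>1\<close> and \<open>M\<^sub>2\<close>; in the variable \<open>J = (\<Theta>, W\<^sup>\<dagger>)\<close> the differential of \<open>H\<close> becomes \<open>- M\<close>
  (\<open>hamiltonian_J_differential\<close>).

  The two equations of the system are the two components of \<open>J' = ad\<^sup>*\<^sub>M J\<close>, the \<open>W\<close>-equation
  after applying the dagger (\<open>f_coad_M_J\<close>). That this is the Hamiltonian flow rests on
  \<open>{F, H}(J) = \<langle>J, [dF, - M]\<rangle> = \<langle>ad\<^sup>*\<^sub>M J, dF\<rangle>\<close>, the derivative of \<open>F\<close> along \<open>ad\<^sup>*\<^sub>M J\<close>. By the chain
  rule a solution curve satisfies \<open>(F \<circ> J)' = {F, H} \<circ> J\<close> for all differentiable \<open>F\<close>; conversely, linear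
  functionals \<open>F\<close> recover the velocity of \<open>J\<close> (\<open>lie_poisson_flow_iff_coadjoint\<close>).\<close>


section \<open>Self-adjoint maps and Schur's lemma\<close>

text \<open>The Rayleigh quotient attains its maximum \<open>r\<close> on the unit sphere, at \<open>v\<close> say. Then
  \<open>w \<mapsto> w \<bullet> f w - r * (w \<bullet> w)\<close> is a nonpositive quadratic form that vanishes at \<open>v\<close>, so its
  first variation there, which is \<open>2 * (w \<bullet> (f v - r *\<^sub>R v))\<close>, must be zero as well.\<close>

lemma self_adjoint_has_eigenvector:
  fixes f :: "'a::euclidean_space \<Rightarrow> 'a"
  assumes lin: "linear f" and sym: "\<And>x y. f x \<bullet> y = x \<bullet> f y"
  obtains r v where "v \<noteq> 0" "f v = r *\<^sub>R v"
proof -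
  have cont: "continuous_on (sphere 0 1) (\<lambda>x. x \<bullet> f x)"
    by (intro continuous_intros linear_continuous_on linear_conv_bounded_linear[THEN iffD1] lin)
  obtain b :: 'a where "b \<in> Basis" using nonempty_Basis by blast
  then have "sphere (0::'a) 1 \<noteq> {}" by (auto intro!: exI[of _ b])
  then obtain v where v: "norm v = 1" and max: "\<And>y. norm y = 1 \<Longrightarrow> y \<bullet> f y \<le> v \<bullet> f v"
    using continuous_attains_sup[OF compact_sphere _ cont] by auto
  define r where "r = v \<bullet> f v"
  define g where "g x = f x - r *\<^sub>R x" for x
  have g_lin: "linear g" unfolding g_def
    by (intro linear_compose_sub lin linear_compose_scale_right linear_id[unfolded id_def])
  have g_sym: "g x \<bullet> y = x \<bullet> g y" for x y
    by (simp add: g_def inner_diff sym)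
  have g_le: "y \<bullet> g y \<le> 0" for y
  proof (cases "y = 0")
    case False
    define u where "u = y /\<^sub>R norm y"
    have y: "y = norm y *\<^sub>R u" and u: "norm u = 1" using False by (simp_all add: u_def)
    have "u \<bullet> f u \<le> r" using max[OF u] by (simp add: r_def)
    then have "u \<bullet> g u \<le> 0"
      using u by (simp add: g_def inner_diff_right dot_square_norm)
    moreover have "y \<bullet> g y = (norm y)\<^sup>2 * (u \<bullet> g u)"
      by (subst (1 2) y) (simp add: linear_scale[OF g_lin] power2_eq_square)
    ultimately show ?thesis by (simp add: mult_nonneg_nonpos)
  qed simp
  have v0: "v \<bullet> g v = 0"
    using v by (simp add: g_def r_def inner_diff_right dot_square_norm)
  have "w \<bullet> g v = 0" for w
  proof (rule ccontr)
    assume ne: "w \<bullet> g v \<noteq> 0"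
    define a where "a = w \<bullet> g v"
    define c where "c = - (w \<bullet> g w)"
    have c: "c \<ge> 0" using g_le[of w] by (simp add: c_def)
    have quad: "2 * t * a \<le> t\<^sup>2 * c" for t
    proof -
      have "(v + t *\<^sub>R w) \<bullet> g (v + t *\<^sub>R w) = 2 * t * a - t\<^sup>2 * c"
        using v0 g_sym[of v w]
        by (simp add: linear_add[OF g_lin] linear_scale[OF g_lin] inner_add a_def c_def
            power2_eq_square inner_commute algebra_simps)
      then show ?thesis using g_le[of "v + t *\<^sub>R w"] by simp
    qed
    \<comment> \<open>small enough for the linear term \<open>2 * t * a\<close> to dominate the quadratic one\<close>
    define t where "t = a / (c + 1)"
    have "a = t * (c + 1)" using c by (simp add: t_def)
    with quad[of t] have "t\<^sup>2 * (c + 2) \<le> 0" by (simp add: algebra_simps power2_eq_square)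
    moreover have "t\<^sup>2 * (c + 2) > 0" using ne c by (simp add: t_def a_def)
    ultimately show False by simp
  qed
  then have "g v = 0" by (metis inner_eq_zero_iff)
  moreover have "v \<noteq> 0" using v by auto
  ultimately show ?thesis using that[of v r] by (simp add: g_def)
qed

lemma dagger_adjoint: "(A *v x) \<bullet> y = x \<bullet> (dagger A *v y)"
  for A :: "'n::finite cmat"
proof -
  have "(A *v x) \<bullet> y = (\<Sum>i\<in>UNIV. \<Sum>j\<in>UNIV. (A $ i $ j * x $ j) \<bullet> y $ i)"
    by (simp add: inner_vec_def matrix_vector_mult_def inner_sum_left)
  also have "\<dots> = (\<Sum>i\<in>UNIV. \<Sum>j\<in>UNIV. x $ j \<bullet> (cnj (A $ i $ j) * y $ i))"
    by (simp add: inner_complex_def algebra_simps)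
  also have "\<dots> = x \<bullet> (dagger A *v y)"
    by (subst sum.swap) (simp add: inner_vec_def matrix_vector_mult_def inner_sum_right dagger_def)
  finally show ?thesis .
qed

text \<open>Schur's lemma: \<open>\<i> A\<close> is Hermitian and so has an eigenvector. The eigenspace is invariant
  under the generators, hence everything; then \<open>A\<close> is scalar, and its trace decides which.\<close>

lemma spin_commutant_su_trivial:
  fixes X :: "3 \<Rightarrow> 'n::finite cmat"
  assumes X: "spin_generators X" and A: "A \<in> su" and comm0: "\<And>a. comm (X a) A = 0"
  shows "A = 0"
proof -
  let ?f = "\<lambda>v. \<i> *s (A *v v)"
  have scale: "(z *s x) \<bullet> y = x \<bullet> (cnj z *s y)" for z and x y :: "complex ^ 'n"
    by (simp add: inner_vec_def inner_complex_def algebra_simps)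
  have "dagger A = - A" using A by (simp add: su_def)
  then have sym: "?f x \<bullet> y = x \<bullet> ?f y" for x y
    by (simp only: scale dagger_adjoint)
      (simp add: vec_eq_iff inner_vec_def matrix_vector_mult_def sum_negf sum_distrib_left algebra_simps)
  have lin: "linear ?f"
    by (rule linearI)
      (simp_all add: vec_eq_iff matrix_vector_mult_def sum.distrib scaleR_sum_right
        sum_distrib_left algebra_simps)
  obtain r v where v: "v \<noteq> 0" and ev: "?f v = r *\<^sub>R v"
    using self_adjoint_has_eigenvector[OF lin sym] by blast
  define c where "c = - \<i> * of_real r"
  have "A *v v = - \<i> *s ?f v" by (simp add: vec_eq_iff)
  also have "\<dots> = c *s v" unfolding ev by (simp add: vec_eq_iff c_def) (simp add: scaleR_conv_of_real)
  finally have Av: "A *v v = c *s v" .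
  define V where "V = {x. A *v x = c *s x}"
  have "vec.subspace V"
    by (simp add: vec.subspace_def V_def matrix_vector_right_distrib vec.scale_right_distrib
        vector_scalar_commute mult.commute)
  moreover have "X a *v x \<in> V" if "x \<in> V" for a x
  proof -
    have "A ** X a = X a ** A" using comm0[of a] by (simp add: comm_def)
    then have "A *v (X a *v x) = X a *v (A *v x)" by (simp add: matrix_vector_mul_assoc)
    then show ?thesis using that by (simp add: V_def vector_scalar_commute)
  qed
  ultimately have "V = {0} \<or> V = UNIV" using X by (simp add: spin_generators_def)
  moreover have "v \<in> V" using Av by (simp add: V_def)
  ultimately have "A *v x = c *s x" for x using v by (auto simp: V_def)
  then have "A = mat c"
    by (simp add: matrix_eq vec_eq_iff matrix_vector_mult_def mat_def if_distrib
        if_distribR cong: if_cong)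
  moreover have "trace A = 0" using A by (simp add: su_def)
  ultimately show ?thesis by (simp add: trace_def mat_def vec_eq_iff)
qed


section \<open>The Hoppe--Yau Laplacian on trace-free skew-Hermitian matrices\<close>

lemma linear_comm: "linear (comm B)" for B :: "'n::finite cmat"
  by (rule linearI)
    (simp_all add: comm_def matrix_matrix_mult_def vec_eq_iff sum.distrib sum_subtractf
      scaleR_sum_right algebra_simps)

lemma linear_hoppe_yau: "linear (hoppe_yau X)"
  unfolding hoppe_yau_def
  by (intro linear_compose_neg linear_compose_scale_right linear_compose_sum ballI
      linear_compose[OF linear_comm linear_comm, unfolded comp_def])

text \<open>A commutator with a Hermitian matrix exchanges Hermitian and skew-Hermitian matrices, so
  the double commutators return to \<^const>\<open>su\<close>.\<close>

lemma hoppe_yau_su: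
  assumes X: "spin_generators X" and A: "A \<in> su"
  shows "hoppe_yau X A \<in> su"
proof -
  have "comm (X a) (comm (X a) A) \<in> su" for a
  proof -
    have "dagger (X a) = X a" "dagger A = - A"
      using X A by (simp_all add: spin_generators_def su_def)
    then show ?thesis
      by (simp add: su_def trace_comm dagger_comm)
        (simp add: comm_def matrix_minus_mult matrix_diff_distrib)
  qed
  then show ?thesis unfolding hoppe_yau_def
    by (intro subspace_neg subspace_scale subspace_sum subspace_su) auto
qed

lemma inner_hoppe_yau:
  fixes X :: "3 \<Rightarrow> 'n::finite cmat"
  assumes "spin_generators X"
  shows "A \<bullet> hoppe_yau X B =
    - (1 / (hbar CARD('n))\<^sup>2) * (\<Sum>a\<in>UNIV. comm (X a) A \<bullet> comm (X a) B)"
proof -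
  have "A \<bullet> comm (X a) (comm (X a) B) = comm (X a) A \<bullet> comm (X a) B" for a
    using assms frob_comm[of A "X a" "comm (X a) B"]
    by (simp add: spin_generators_def frob_eq_inner)
  then show ?thesis by (simp add: hoppe_yau_def inner_sum_right)
qed

lemma hoppe_yau_self_adjoint:
  "spin_generators X \<Longrightarrow> A \<bullet> hoppe_yau X B = hoppe_yau X A \<bullet> B"
  by (simp add: inner_hoppe_yau inner_commute[of "hoppe_yau X A"]) (simp add: inner_commute)

text \<open>By \<open>inner_hoppe_yau\<close> an element of the kernel commutes with all generators.\<close>

lemma hoppe_yau_inj_on_su:
  fixes X :: "3 \<Rightarrow> 'n::finite cmat"
  assumes X: "spin_generators X" and N: "CARD('n) \<ge> 2"
  shows "inj_on (hoppe_yau X) su"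
proof (subst linear_inj_on_iff_eq_0[OF linear_hoppe_yau subspace_su], intro ballI impI)
  fix A :: "'n cmat" assume A: "A \<in> su" and eq: "hoppe_yau X A = 0"
  have "(real CARD('n))\<^sup>2 > 1" using N by (simp add: power2_eq_square less_1_mult)
  then have "hbar CARD('n) \<noteq> 0" by (simp add: hbar_def)
  then have "(\<Sum>a\<in>UNIV. comm (X a) A \<bullet> comm (X a) A) = 0"
    using inner_hoppe_yau[OF X, of A A] eq by simp
  then have "comm (X a) A = 0" for a
    by (subst (asm) sum_nonneg_eq_0_iff) auto
  then show "A = 0" by (rule spin_commutant_su_trivial[OF X A])
qed

lemma hoppe_yau_bij_su:
  fixes X :: "3 \<Rightarrow> 'n::finite cmat"
  assumes X: "spin_generators X" and N: "CARD('n) \<ge> 2"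
  shows "bij_betw (hoppe_yau X) su su"
proof -
  have span: "span su = (su :: 'n cmat set)" by (simp add: subspace_su)
  have "dim (hoppe_yau X ` su) = dim (su :: 'n cmat set)"
    by (rule dim_image_eq[OF linear_hoppe_yau]) (simp only: span hoppe_yau_inj_on_su[OF X N])
  then have "hoppe_yau X ` su = su"
    using hoppe_yau_su[OF X]
    by (intro subspace_dim_equal linear_subspace_image linear_hoppe_yau subspace_su) auto
  then show ?thesis using hoppe_yau_inj_on_su[OF X N] by (simp add: bij_betw_def)
qed

text \<open>Off \<^const>\<open>su\<close> the inverse is an arbitrary function. Replacing it by a linear map that agrees
  with it on \<^const>\<open>su\<close> makes the calculus of quadratic forms available.\<close>

lemma hoppe_yau_inv_linear_extension:
  fixes X :: "3 \<Rightarrow> 'n::finite cmat"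
  assumes X: "spin_generators X" and N: "CARD('n) \<ge> 2"
  obtains g where "linear g" "\<And>U. U \<in> su \<Longrightarrow> g U = hoppe_yau_inv X U"
    "\<And>U. U \<in> su \<Longrightarrow> g U \<in> su" "\<And>U V. U \<in> su \<Longrightarrow> V \<in> su \<Longrightarrow> U \<bullet> g V = g U \<bullet> V"
proof -
  note bij = hoppe_yau_bij_su[OF X N]
  obtain g where lin: "linear g" and g: "\<And>A. A \<in> su \<Longrightarrow> g (hoppe_yau X A) = A"
    using linear_exists_left_inverse_on[OF linear_hoppe_yau subspace_su hoppe_yau_inj_on_su[OF X N]]
    by blast
  have inv: "hoppe_yau_inv X U \<in> su" "hoppe_yau X (hoppe_yau_inv X U) = U" if "U \<in> su" for U
    using bij that unfolding hoppe_yau_inv_def bij_betw_def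
    by (metis inv_into_into, metis f_inv_into_f)
  have eq: "g U = hoppe_yau_inv X U" if "U \<in> su" for U
    using g[OF inv(1)[OF that]] inv(2)[OF that] by simp
  have "U \<bullet> g V = g U \<bullet> V" if "U \<in> su" "V \<in> su" for U V
    using hoppe_yau_self_adjoint[OF X, of "g U" "g V"] that by (simp add: eq inv)
  then show ?thesis using that[of g] lin eq inv(1) by simp
qed


section \<open>Derivatives within a subspace\<close>

text \<open>A derivative within a subspace is compared with increments between points of the subspace only,
  so its values elsewhere are free. This allows a derivative to be replaced by the representative
  that a definition prescribes.\<close>

lemma has_derivative_within_subspace_cong:
  assumes "(f has_derivative D) (at x within S)" "subspace S" "x \<in> S"
    and "bounded_linear D'" "\<And>k. k \<in> S \<Longrightarrow> D' k = D k"
  shows "(f has_derivative D') (at x within S)"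
proof -
  have "D' (y - x) = D (y - x)" if "y \<in> S" for y
    using assms that by (simp add: subspace_diff)
  then show ?thesis using assms(1,4) unfolding has_derivative_within' by simp
qed

text \<open>The product rule yields \<open>x \<bullet> L k + k \<bullet> L x\<close>, where the two terms agree for increments \<open>k\<close> in the
  subspace.\<close>

lemma quadratic_form_has_derivative_within:
  fixes L :: "'a::euclidean_space \<Rightarrow> 'a"
  assumes "linear L" "subspace S" "x \<in> S" and sym: "\<And>u v. u \<in> S \<Longrightarrow> v \<in> S \<Longrightarrow> u \<bullet> L v = L u \<bullet> v"
  shows "((\<lambda>u. (u \<bullet> L u) / 2) has_derivative (\<lambda>k. k \<bullet> L x)) (at x within S)"
proof (rule has_derivative_within_subspace_cong)
  have "(L has_derivative L) (at x within S)"
    using assms(1) by (simp add: bounded_linear_imp_has_derivative linear_conv_bounded_linear)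
  then show "((\<lambda>u. (u \<bullet> L u) / 2) has_derivative (\<lambda>k. (x \<bullet> L k + k \<bullet> L x) / 2)) (at x within S)"
    by (auto intro!: derivative_eq_intros)
  show "k \<bullet> L x = (x \<bullet> L k + k \<bullet> L x) / 2" if "k \<in> S" for k
    using sym[OF \<open>x \<in> S\<close> that] by (simp add: inner_commute)
qed (use assms in \<open>auto intro: bounded_linear_inner_left\<close>)

lemma riesz_representation_on_subspace:
  fixes D :: "'a::euclidean_space \<Rightarrow> real"
  assumes "linear D" "subspace S"
  obtains z where "z \<in> S" "\<And>k. k \<in> S \<Longrightarrow> D k = k \<bullet> z"
proof -
  define z where "z = adjoint D 1"
  have z: "D k = k \<bullet> z" for k
    using adjoint_works[OF assms(1), of k 1] by (simp add: z_def)
  obtain p q where p: "p \<in> S" and q: "\<And>w. w \<in> S \<Longrightarrow> orthogonal q w" and "z = p + q"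
    using orthogonal_subspace_decomp_exists[of S z] span_eq_iff[of S] assms(2) by metis
  then have "D k = k \<bullet> p" if "k \<in> S" for k
    using q[OF that] by (simp add: z inner_add_right orthogonal_def inner_commute)
  then show ?thesis using that p by blast
qed


section \<open>Differentials and the bracket on the dual\<close>

lemma subspace_f_dual: "subspace f_dual"
  unfolding f_dual_def by (rule subspace_Times[OF subspace_su subspace_su])

lemma f_pair_inner: "f_pair K (w, b) = K \<bullet> (b, w)"
  by (cases K) (simp add: frob_eq_inner inner_commute)

lemma f_coad_closed: "x \<in> f_alg \<Longrightarrow> J \<in> f_dual \<Longrightarrow> f_coad x J \<in> f_dual"
  by (cases x; cases J)
    (auto simp: f_alg_def f_dual_def intro!: comm_su su_coad_su subspace_diff[OF subspace_su])

lemma f_ad_minus_right: "f_ad x (- y) = f_ad y x"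
  by (cases x; cases y) (simp add: comm_def su_coad_def dagger_minus matrix_minus_mult)

lemma differential_eqI:
  "has_differential F J \<xi> \<Longrightarrow> J \<in> f_dual \<Longrightarrow> differential F J = \<xi>"
  unfolding differential_def by (blast intro: has_differential_unique)

text \<open>The Riesz vector of the derivative on the subspace \<^const>\<open>f_dual\<close> has the defining property of
  the differential, up to the order of the components.\<close>

lemma f_pair_differential:
  assumes F: "(F has_derivative D) (at J within f_dual)" and J: "J \<in> f_dual" and K: "K \<in> f_dual"
  shows "f_pair K (differential F J) = D K"
proof -
  have "linear D" using F by (simp add: has_derivative_linear)
  then obtain z where z: "z \<in> f_dual" and D: "\<And>K. K \<in> f_dual \<Longrightarrow> D K = K \<bullet> z"
    using riesz_representation_on_subspace[OF _ subspace_f_dual] by blast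
  define \<xi> where "\<xi> = (snd z, fst z)"
  have pair: "f_pair K \<xi> = K \<bullet> z" for K by (simp add: \<xi>_def f_pair_inner)
  have "(F has_derivative (\<lambda>K. K \<bullet> z)) (at J within f_dual)"
    using F subspace_f_dual J bounded_linear_inner_left D[symmetric]
    by (rule has_derivative_within_subspace_cong)
  moreover have "\<xi> \<in> f_alg" using z by (auto simp: \<xi>_def f_alg_def f_dual_def)
  ultimately have "has_differential F J \<xi>" by (simp add: has_differential_def pair)
  then show ?thesis using D[OF K] by (simp add: differential_eqI[OF _ J] pair)
qed

text \<open>The coadjoint operator is the transpose of the bracket, so \<open>\<langle>J, [dF, -M]\<rangle> = \<langle>J, [M, dF]\<rangle> =
  \<langle>ad\<^sup>*\<^sub>M J, dF\<rangle>\<close>: the bracket with \<open>H\<close> differentiates along the coadjoint vector field.\<close>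

lemma lie_poisson_eq_derivative_along_coad:
  assumes H: "has_differential H J (- M)" and M: "M \<in> f_alg" and J: "J \<in> f_dual"
    and F: "(F has_derivative D) (at J within f_dual)"
  shows "lie_poisson F H J = D (f_coad M J)"
proof -
  have "lie_poisson F H J = f_pair (f_coad M J) (differential F J)"
    by (simp add: lie_poisson_def differential_eqI[OF H J] f_ad_minus_right f_coad_transpose)
  then show ?thesis
    using f_pair_differential[OF F J f_coad_closed[OF M J]] by simp
qed

text \<open>Along a curve, the chain rule gives one direction; for the other, the coordinate functionals
  are test functions that recover the velocity.\<close>

lemma lie_poisson_flow_iff_coadjoint:
  assumes H: "\<And>K. K \<in> f_dual \<Longrightarrow> has_differential H K (- M K)"
    and M: "\<And>K. K \<in> f_dual \<Longrightarrow> M K \<in> f_alg"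
    and J: "\<And>t. t \<in> T \<Longrightarrow> J t \<in> f_dual"
  shows "lie_poisson_flow H T J \<longleftrightarrow>
    (\<forall>t\<in>T. (J has_vector_derivative f_coad (M (J t)) (J t)) (at t within T))"
proof
  assume flow: "lie_poisson_flow H T J"
  show "\<forall>t\<in>T. (J has_vector_derivative f_coad (M (J t)) (J t)) (at t within T)"
  proof
    fix t assume t: "t \<in> T"
    show "(J has_vector_derivative f_coad (M (J t)) (J t)) (at t within T)"
      unfolding has_vector_derivative_def
    proof (subst has_derivative_componentwise_within, intro ballI)
      fix i :: "'a cmat \<times> 'a cmat"
      have D: "((\<lambda>K. K \<bullet> i) has_derivative (\<lambda>K. K \<bullet> i)) (at K within f_dual)" for K
        by (rule bounded_linear_imp_has_derivative[OF bounded_linear_inner_left])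
      then have "(\<lambda>K. K \<bullet> i) differentiable_on f_dual"
        unfolding differentiable_on_def differentiable_def by blast
      then have "((\<lambda>s. J s \<bullet> i) has_real_derivative lie_poisson (\<lambda>K. K \<bullet> i) H (J t)) (at t within T)"
        using flow t unfolding lie_poisson_flow_def by blast
      moreover have "lie_poisson (\<lambda>K. K \<bullet> i) H (J t) = f_coad (M (J t)) (J t) \<bullet> i"
        using H M J t D by (intro lie_poisson_eq_derivative_along_coad) auto
      ultimately show "((\<lambda>s. J s \<bullet> i) has_derivative (\<lambda>s. (s *\<^sub>R f_coad (M (J t)) (J t)) \<bullet> i))
          (at t within T)"
        by (simp add: has_field_derivative_def mult_commute_abs)
    qed
  qed
next
  assume ode: "\<forall>t\<in>T. (J has_vector_derivative f_coad (M (J t)) (J t)) (at t within T)"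
  have "((\<lambda>s. F (J s)) has_real_derivative lie_poisson F H (J t)) (at t within T)"
    if F: "F differentiable_on f_dual" and t: "t \<in> T" for F t
  proof -
    obtain D where D: "(F has_derivative D) (at (J t) within f_dual)"
      using F J[OF t] unfolding differentiable_on_def differentiable_def by blast
    have "(F has_derivative D) (at (J t) within J ` T)"
      using D by (rule has_derivative_subset) (use J in auto)
    moreover have "(J has_derivative (\<lambda>s. s *\<^sub>R f_coad (M (J t)) (J t))) (at t within T)"
      using ode t by (simp add: has_vector_derivative_def)
    ultimately have "((\<lambda>s. F (J s)) has_derivative (\<lambda>s. D (s *\<^sub>R f_coad (M (J t)) (J t))))
        (at t within T)"
      by (rule has_derivative_in_compose[rotated])
    moreover have "lie_poisson F H (J t) = D (f_coad (M (J t)) (J t))"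
      using H M J t D by (intro lie_poisson_eq_derivative_along_coad) auto
    moreover have "linear D" using D by (simp add: has_derivative_linear)
    ultimately show ?thesis
      by (simp add: has_field_derivative_def linear_scale mult_commute_abs)
  qed
  moreover have "H differentiable_on f_dual"
    using H unfolding has_differential_def differentiable_on_def differentiable_def by blast
  ultimately show "lie_poisson_flow H T J"
    using J by (simp add: lie_poisson_flow_def)
qed


section \<open>The Hamiltonian and the system\<close>

lemma dagger_su: "A \<in> su \<Longrightarrow> dagger A \<in> su"
  by (simp add: su_def dagger_minus trace_minus)

lemma J_of_f_dual: "W \<in> su \<Longrightarrow> \<Theta> \<in> su \<Longrightarrow> J_of W \<Theta> \<in> f_dual"
  by (simp add: J_of_def f_dual_def dagger_su)

lemma hoppe_yau_inv_su:
  fixes X :: "3 \<Rightarrow> 'n::finite cmat"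
  assumes "spin_generators X" "CARD('n) \<ge> 2" "W \<in> su"
  shows "hoppe_yau_inv X W \<in> su"
  using hoppe_yau_inv_linear_extension[OF assms(1,2)] assms(3) by metis

lemma M_of_f_alg:
  fixes X :: "3 \<Rightarrow> 'n::finite cmat"
  assumes "spin_generators X" "CARD('n) \<ge> 2" "W \<in> su" "\<Theta> \<in> su"
  shows "M_of X W \<Theta> \<in> f_alg"
  using assms by (simp add: M_of_def f_alg_def hoppe_yau_inv_su hoppe_yau_su dagger_su)

lemma hamiltonian_gradient_W:
  fixes X :: "3 \<Rightarrow> 'n::finite cmat"
  assumes X: "spin_generators X" and N: "CARD('n) \<ge> 2" and W: "W \<in> su"
  shows "has_frob_gradient (\<lambda>U. hamiltonian X U \<Theta>) W (hoppe_yau_inv X W)"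
proof -
  obtain g where lin: "linear g" and g: "\<And>U. U \<in> su \<Longrightarrow> g U = hoppe_yau_inv X U"
    and sym: "\<And>U V. U \<in> su \<Longrightarrow> V \<in> su \<Longrightarrow> U \<bullet> g V = g U \<bullet> V"
    using hoppe_yau_inv_linear_extension[OF X N] by metis
  have "((\<lambda>U. (U \<bullet> g U) / 2 + frob \<Theta> (hoppe_yau X \<Theta>) / 2) has_derivative (\<lambda>K. K \<bullet> g W))
      (at W within su)"
    using has_derivative_add[OF quadratic_form_has_derivative_within[OF lin subspace_su W sym]
        has_derivative_const]
    by simp
  then have "((\<lambda>U. hamiltonian X U \<Theta>) has_derivative (\<lambda>K. K \<bullet> g W)) (at W within su)"
    by (rule has_derivative_transform[OF W, rotated])
      (simp add: hamiltonian_def frob_eq_inner g add_divide_distrib)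
  moreover have "(\<lambda>K. K \<bullet> g W) = frob (hoppe_yau_inv X W)"
    by (simp add: fun_eq_iff frob_eq_inner g[OF W] inner_commute)
  ultimately show ?thesis
    using hoppe_yau_inv_su[OF X N W] by (simp add: has_frob_gradient_def)
qed

lemma hamiltonian_gradient_Theta:
  fixes X :: "3 \<Rightarrow> 'n::finite cmat"
  assumes X: "spin_generators X" and \<Theta>: "\<Theta> \<in> su"
  shows "has_frob_gradient (\<lambda>U. hamiltonian X W U) \<Theta> (hoppe_yau X \<Theta>)"
proof -
  have "((\<lambda>U. frob W (hoppe_yau_inv X W) / 2 + (U \<bullet> hoppe_yau X U) / 2) has_derivative
      (\<lambda>K. K \<bullet> hoppe_yau X \<Theta>)) (at \<Theta> within su)"
    using has_derivative_add[OF has_derivative_const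
        quadratic_form_has_derivative_within[OF linear_hoppe_yau subspace_su \<Theta>
          hoppe_yau_self_adjoint[OF X]]]
    by simp
  moreover have "(\<lambda>K. K \<bullet> hoppe_yau X \<Theta>) = frob (hoppe_yau X \<Theta>)"
    by (simp add: fun_eq_iff frob_eq_inner inner_commute)
  ultimately show ?thesis
    using hoppe_yau_su[OF X \<Theta>]
    by (simp add: has_frob_gradient_def hamiltonian_def frob_eq_inner add_divide_distrib)
qed

text \<open>On the dual the Hamiltonian is the quadratic form of \<open>(\<xi>, a) \<mapsto> (\<Delta> \<xi>, \<Delta>\<^sup>-\<^sup>1 a)\<close>. The minus sign
  arises because \<open>W\<^sup>\<dagger> = - W\<close> and \<open>M\<^sub>2\<^sup>\<dagger> = - M\<^sub>2\<close>: at \<open>(\<Theta>, W\<^sup>\<dagger>)\<close> the gradient is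
  \<open>(M\<^sub>2, - M\<^sub>1) = - (M\<^sub>2\<^sup>\<dagger>, M\<^sub>1)\<close>, and the pairing interchanges the two components.\<close>

lemma hamiltonian_J_differential:
  fixes X :: "3 \<Rightarrow> 'n::finite cmat"
  assumes X: "spin_generators X" and N: "CARD('n) \<ge> 2" and W: "W \<in> su" and \<Theta>: "\<Theta> \<in> su"
  shows "has_differential (hamiltonian_J X) (J_of W \<Theta>) (- M_of X W \<Theta>)"
proof -
  obtain g where lin: "linear g" and g: "\<And>U. U \<in> su \<Longrightarrow> g U = hoppe_yau_inv X U"
    and sym: "\<And>U V. U \<in> su \<Longrightarrow> V \<in> su \<Longrightarrow> U \<bullet> g V = g U \<bullet> V"
    using hoppe_yau_inv_linear_extension[OF X N] by metis
  define L where "L K = (hoppe_yau X (fst K), g (snd K))" for K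
  have L_lin: "linear L"
    by (rule linearI)
      (simp_all add: L_def linear_add[OF lin] linear_scale[OF lin] linear_add[OF linear_hoppe_yau]
        linear_scale[OF linear_hoppe_yau])
  have L_sym: "K \<bullet> L K' = L K \<bullet> K'" if "K \<in> f_dual" "K' \<in> f_dual" for K K'
    using that sym hoppe_yau_self_adjoint[OF X] by (auto simp: L_def f_dual_def inner_prod_def)
  have H: "hamiltonian_J X K = (K \<bullet> L K) / 2" if K_dual: "K \<in> f_dual" for K
  proof -
    obtain \<xi> a where K: "K = (\<xi>, a)" "a \<in> su" using K_dual by (auto simp: f_dual_def)
    then have "dagger a = - a" "dagger a \<in> su" by (simp_all add: dagger_su) (simp add: su_def)
    then show ?thesis
      using K by (simp add: hamiltonian_def frob_eq_inner L_def g[symmetric] linear_neg[OF lin])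
  qed
  have "dagger W = - W" "dagger (hoppe_yau X \<Theta>) = - hoppe_yau X \<Theta>"
    using W hoppe_yau_su[OF X \<Theta>] by (simp_all add: su_def)
  then have "K \<bullet> L (J_of W \<Theta>) = f_pair K (- M_of X W \<Theta>)" for K
    by (simp add: J_of_def M_of_def L_def f_pair_inner linear_neg[OF lin] g[OF W])
  moreover note J = J_of_f_dual[OF W \<Theta>]
  moreover have "(hamiltonian_J X has_derivative (\<lambda>K. K \<bullet> L (J_of W \<Theta>))) (at (J_of W \<Theta>) within f_dual)"
    by (rule has_derivative_transform[OF J H
          quadratic_form_has_derivative_within[OF L_lin subspace_f_dual J L_sym]])
  moreover have "- M_of X W \<Theta> \<in> f_alg"
    using M_of_f_alg[OF X N W \<Theta>]
    by (auto simp: M_of_def f_alg_def intro: subspace_neg[OF subspace_su])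
  ultimately show ?thesis by (simp add: has_differential_def)
qed

lemma f_coad_M_J:
  "f_coad (M_of X W \<Theta>) (J_of W \<Theta>) =
    J_of (comm W (hoppe_yau_inv X W) + comm \<Theta> (hoppe_yau X \<Theta>)) (comm \<Theta> (hoppe_yau_inv X W))"
  by (simp add: M_of_def J_of_def su_coad_def dagger_add dagger_comm) (simp add: comm_def)

lemma J_of_has_vector_derivative_iff:
  "((\<lambda>s. J_of (W s) (\<Theta> s)) has_vector_derivative J_of W' \<Theta>') (at t within T) \<longleftrightarrow>
    (W has_vector_derivative W') (at t within T) \<and> (\<Theta> has_vector_derivative \<Theta>') (at t within T)"
  for W \<Theta> :: "real \<Rightarrow> 'n::finite cmat"
proof -
  have dag: "bounded_linear (dagger :: 'n cmat \<Rightarrow> 'n cmat)"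
    by (simp add: linear_conv_bounded_linear[symmetric] linearI dagger_add dagger_scaleR)
  show ?thesis (is "?J \<longleftrightarrow> ?W \<and> ?T")
  proof
    assume J: ?J
    have ?W
      using bounded_linear.has_vector_derivative[OF dag
          bounded_linear.has_vector_derivative[OF bounded_linear_snd J]]
      by (simp add: J_of_def)
    moreover have ?T
      using bounded_linear.has_vector_derivative[OF bounded_linear_fst J] by (simp add: J_of_def)
    ultimately show "?W \<and> ?T" ..
  next
    assume "?W \<and> ?T"
    then show ?J unfolding J_of_def
      by (auto intro!: has_vector_derivative_Pair bounded_linear.has_vector_derivative[OF dag])
  qed
qed

lemma solves_system_iff_coadjoint:
  "solves_system X T W \<Theta> \<longleftrightarrow>
    (\<forall>t\<in>T. ((\<lambda>s. J_of (W s) (\<Theta> s)) has_vector_derivative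
       f_coad (M_of X (W t) (\<Theta> t)) (J_of (W t) (\<Theta> t))) (at t within T))"
  by (simp add: solves_system_def f_coad_M_J J_of_has_vector_derivative_iff Let_def)

lemma solves_system_iff_lie_poisson_flow:
  fixes X :: "3 \<Rightarrow> 'n::finite cmat"
  assumes X: "spin_generators X" and N: "CARD('n) \<ge> 2"
    and su: "\<And>t. t \<in> T \<Longrightarrow> W t \<in> su \<and> \<Theta> t \<in> su"
  shows "solves_system X T W \<Theta> \<longleftrightarrow> lie_poisson_flow (hamiltonian_J X) T (\<lambda>t. J_of (W t) (\<Theta> t))"
proof -
  \<comment> \<open>the Lie algebra element \<open>M\<close> as a function of \<open>J = (\<Theta>, W\<^sup>\<dagger>)\<close>\<close>
  define M where "M K = M_of X (dagger (snd K)) (fst K)" for K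
  have M_J: "M (J_of U \<Phi>) = M_of X U \<Phi>" for U \<Phi> by (simp add: M_def J_of_def)
  have "has_differential (hamiltonian_J X) K (- M K) \<and> M K \<in> f_alg" if "K \<in> f_dual" for K
  proof -
    have K: "dagger (snd K) \<in> su" "fst K \<in> su" "K = J_of (dagger (snd K)) (fst K)"
      using that by (auto simp: f_dual_def J_of_def dagger_su)
    then show ?thesis
      using hamiltonian_J_differential[OF X N K(1,2)] M_of_f_alg[OF X N K(1,2)] by (simp add: M_def)
  qed
  then show ?thesis
    using su
    by (subst lie_poisson_flow_iff_coadjoint[where M = M])
      (auto simp: solves_system_iff_coadjoint M_J J_of_f_dual)
qed

theorem proposition2:
  fixes X :: "3 \<Rightarrow> complex ^ 'n ^ 'n"
  assumes "CARD('n) \<ge> 2"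
    and "spin_generators X"
  shows
    "(\<forall>W\<in>su. \<forall>\<Theta>\<in>su.
        J_of W \<Theta> \<in> f_dual \<and> M_of X W \<Theta> \<in> f_alg \<and>
        complex_of_real (hamiltonian X W \<Theta>) =
          (1 / 2) * (trace (dagger W ** hoppe_yau_inv X W) + trace (dagger \<Theta> ** hoppe_yau X \<Theta>)) \<and>
        has_frob_gradient (\<lambda>U. hamiltonian X U \<Theta>) W (hoppe_yau_inv X W) \<and>
        has_frob_gradient (\<lambda>U. hamiltonian X W U) \<Theta> (hoppe_yau X \<Theta>) \<and>
        has_differential (hamiltonian_J X) (J_of W \<Theta>) (- M_of X W \<Theta>)) \<and>
     (\<forall>T W \<Theta>. is_interval T \<and> (\<forall>t\<in>T. W t \<in> su \<and> \<Theta> t \<in> su) \<longrightarrow>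
        (solves_system X T W \<Theta> \<longleftrightarrow>
           (\<forall>t\<in>T. ((\<lambda>s. J_of (W s) (\<Theta> s)) has_vector_derivative
               f_coad (M_of X (W t) (\<Theta> t)) (J_of (W t) (\<Theta> t))) (at t within T))) \<and>
        (solves_system X T W \<Theta> \<longleftrightarrow>
           lie_poisson_flow (hamiltonian_J X) T (\<lambda>t. J_of (W t) (\<Theta> t))))"
proof -
  note N = assms(1) and X = assms(2)
  have energy: "complex_of_real (hamiltonian X W \<Theta>) =
      (1 / 2) * (trace (dagger W ** hoppe_yau_inv X W) + trace (dagger \<Theta> ** hoppe_yau X \<Theta>))"
    if "W \<in> su" "\<Theta> \<in> su" for W \<Theta>
    using that
    by (simp add: hamiltonian_def trace_dagger_mult_su hoppe_yau_su[OF X] hoppe_yau_inv_su[OF X N])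
  show ?thesis
    by (intro conjI ballI allI impI energy J_of_f_dual M_of_f_alg[OF X N]
        hamiltonian_gradient_W[OF X N] hamiltonian_gradient_Theta[OF X]
        hamiltonian_J_differential[OF X N] solves_system_iff_coadjoint
        solves_system_iff_lie_poisson_flow[OF X N]) auto
qed

end
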